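(* A maximal $2$-cap in $\mathbb{F}_3^5$ has size $13$, i.e. $r(2,\mathbb{F}_3^5)=13$.
   Context: $\mathbb{F}_3^n$ denotes $n$-dimensional affine space over the field with three elements. A subset $C \subseteq \mathbb{F}_3^n$ is a $2$-cap if no three points of $C$ lie on a $1$-dimensional affine subspace and no four points of $C$ lie on a $2$-dimensional affine subspace (equivalently, every subset of $C$ of size at most $4$ is affinely independent). $r(2,\mathbb{F}_3^n)$ denotes the largest cardinality of a $2$-cap in $\mathbb{F}_3^n$; a maximal $2$-cap is one of this cardinality. *)

theory Defs
  imports "HOL-Analysis.Analysis"
begin

text \<open>The library type \<open>Enum.finite_3\<close> is an instance of \<^class>\<open>field\<close>, with
  arithmetic modulo 3 on its three elements.\<close>

type_synonym F3 = Enum.finite_3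

definition affine_subspace :: "nat \<Rightarrow> ('a::field ^ 'n) set \<Rightarrow> bool" where
  "affine_subspace d A \<longleftrightarrow>
     (\<exists>S p. vec.subspace S \<and> vec.dim S = d \<and> A = (\<lambda>v. p + v) ` S)"

definition two_cap :: "('a::field ^ 'n) set \<Rightarrow> bool" where
  "two_cap C \<longleftrightarrow>
     (\<forall>T\<subseteq>C. card T = 3 \<longrightarrow> \<not> (\<exists>A. affine_subspace 1 A \<and> T \<subseteq> A)) \<and>
     (\<forall>T\<subseteq>C. card T = 4 \<longrightarrow> \<not> (\<exists>A. affine_subspace 2 A \<and> T \<subseteq> A))"

text \<open>The argument only names the ambient space. As that space is finite and the empty set is a
  2-cap, the maximum is taken over a finite nonempty set.\<close>

definition r2 :: "('a::{field,finite} ^ 'n) itself \<Rightarrow> nat" where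
  "r2 _ = Max (card ` {C :: ('a ^ 'n) set. two_cap C})"

definition maximal_two_cap :: "('a::{field,finite} ^ 'n) set \<Rightarrow> bool" where
  "maximal_two_cap C \<longleftrightarrow> two_cap C \<and> card C = r2 TYPE('a ^ 'n)"

end

theory Submission
  imports Defs
begin

text \<open>
  A 2-cap over the field with three elements is the same as a Sidon set: the sum \<open>a + b\<close> of two
  members determines \<open>{a, b}\<close>. Suppose a Sidon set \<open>C\<close> in dimension 5 had 14 points. For
  \<open>z \<in> C\<close> the 183 differences of \<open>C\<close> and the 78 points \<open>u + v + z\<close> with \<open>u \<noteq> v\<close> in \<open>C - {z}\<close>
  cannot be disjoint in a space of 243 points; this gives distinct points of \<open>C\<close> with
  \<open>e = a + b + c + d\<close>. The solid \<open>V\<close> through them contains no further point of \<open>C\<close>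
  (six points have 30 differences, but \<open>V\<close> has only 26 nonzero directions), so one of the
  four hyperplanes \<open>H\<close> through \<open>V\<close> contains three of the other nine points. Two of those three, \<open>f\<close> and
  \<open>g\<close>, lie in the same coset of \<open>V\<close>, and the Sidon property leaves, up to symmetry, only
  \<open>g - f = a + b - c - d\<close>. As \<open>H\<close> contains at most 9 points of \<open>C\<close>, some parallel of \<open>H\<close> contains
  three. In suitable coordinates 8 points of \<open>C\<close> are now fixed, and a small exhaustive search
  excludes every way to complete them to 14 points.
\<close>

text \<open>Over the prime field with three elements, scalar multiplication is repeated addition, so
  the additive group alone carries the argument.\<close>

class ab_group_exp3 = ab_group_add +
  assumes triple: "x + x + x = 0"
begin

text \<open>Together with \<open>add_ac\<close> these rules remove minus signs and cancel triples,
  so that identities between combinations of points become provable by rewriting.\<close>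

lemma exp3_simps:
  "- x = x + x" "x - y = x + (y + y)" "x + (x + x) = 0" "x + (x + (x + y)) = y"
proof -
  show *: "- x = x + x" for x by (metis add.assoc minus_unique triple add.commute)
  show "x - y = x + (y + y)" using *[of y] by (metis diff_conv_add_uminus)
  show "x + (x + x) = 0" "x + (x + (x + y)) = y"
    using triple by (simp_all add: add.assoc [symmetric])
qed

end

section \<open>Sidon sets in groups of exponent 3\<close>

definition sidon :: "'a::ab_group_add set \<Rightarrow> bool" where
  "sidon C \<longleftrightarrow> (\<forall>a\<in>C. \<forall>b\<in>C. \<forall>c\<in>C. \<forall>d\<in>C. a + b = c + d \<longrightarrow> a = c \<and> b = d \<or> a = d \<and> b = c)"

lemma sidonD:
  "\<lbrakk>sidon C; a + b = c + d; a \<in> C; b \<in> C; c \<in> C; d \<in> C\<rbrakk> \<Longrightarrow> a = c \<and> b = d \<or> a = d \<and> b = c"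
  unfolding sidon_def by blast

lemma sidon_diffD:
  assumes "sidon C" "x - y = u - v" "x \<in> C" "y \<in> C" "u \<in> C" "v \<in> C"
  shows "x = y \<and> u = v \<or> x = u \<and> y = v"
proof -
  have "x + v = u + y" using assms(2) by (simp add: algebra_simps)
  from sidonD[OF assms(1) this] show ?thesis using assms by auto
qed

lemma sidon_subset: "sidon C \<Longrightarrow> D \<subseteq> C \<Longrightarrow> sidon D"
  unfolding sidon_def by blast

text \<open>Three distinct points with sum zero form a line. As \<open>- c = c + c\<close>, this is
  the Sidon condition with a repeated summand.\<close>

lemma sidon_sum_zeroD:
  fixes a b c :: "'a::ab_group_exp3"
  assumes "sidon C" "a + b + c = 0" "a \<in> C" "b \<in> C" "c \<in> C"
  shows "a = c \<and> b = c"
proof -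
  have "a + b = - c" using assms(2) by (simp add: eq_neg_iff_add_eq_0)
  then have "a + b = c + c" by (simp add: exp3_simps)
  from sidonD[OF assms(1) this] show ?thesis using assms by auto
qed

text \<open>Ordered pairs of distinct points have pairwise different nonzero differences; the extra
  1 counts the difference 0.\<close>

lemma card_differences:
  assumes "sidon C" "finite C" "C \<noteq> {}"
  shows "card {x - y |x y. x \<in> C \<and> y \<in> C} = card C * (card C - 1) + 1"
proof -
  let ?P = "C \<times> C - (\<lambda>x. (x, x)) ` C" and ?d = "\<lambda>(x, y). x - y"
  have "inj_on ?d ?P"
  proof (rule inj_onI)
    fix p q assume "p \<in> ?P" "q \<in> ?P" "?d p = ?d q"
    then show "p = q" using sidon_diffD[OF assms(1)] by (cases p; cases q) fastforce
  qed
  moreover have "card ?P = card C * (card C - 1)"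
    using assms(2) by (subst card_Diff_subset)
      (auto simp: card_cartesian_product card_image inj_on_def diff_mult_distrib2)
  moreover have "{x - y |x y. x \<in> C \<and> y \<in> C} = insert 0 (?d ` ?P)" (is "?D = _")
  proof (intro set_eqI iffI)
    fix z assume "z \<in> ?D"
    then obtain x y where "z = x - y" "x \<in> C" "y \<in> C" by blast
    then show "z \<in> insert 0 (?d ` ?P)"
      by (cases "x = y") (auto intro!: image_eqI[where x = "(x, y)"])
  next
    fix z assume z: "z \<in> insert 0 (?d ` ?P)"
    obtain x where "x \<in> C" using assms(3) by blast
    then have "0 \<in> ?D" by (metis (mono_tags, lifting) diff_self mem_Collect_eq)
    with z show "z \<in> ?D" by auto
  qed
  moreover have "0 \<notin> ?d ` ?P" by auto
  ultimately show ?thesis using assms(2) by (simp add: card_image)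
qed

text \<open>Used with \<open>W\<close> the direction space of a flat containing \<open>C\<close>.
  The inequality is strict because 0 also occupies a place in \<open>W\<close>.\<close>

lemma card_sidon_in_coset_le:
  assumes "sidon C" "finite W" "0 \<in> W" "finite C" "\<And>x y. x \<in> C \<Longrightarrow> y \<in> C \<Longrightarrow> x - y \<in> W"
  shows "card C * (card C - 1) < card W"
proof (cases "C = {}")
  case True
  then show ?thesis using assms(2,3) by (auto simp: card_gt_0_iff)
next
  case False
  have "card {x - y |x y. x \<in> C \<and> y \<in> C} \<le> card W"
    using assms by (intro card_mono) auto
  then show ?thesis using card_differences[OF assms(1,4) False] by simp
qed

lemma sidon_five_dependency:
  fixes C :: "'a::{ab_group_exp3,finite} set"
  assumes C: "sidon C" "card C = 14" and card: "CARD('a) = 243"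
  obtains a b c d e where "{a, b, c, d, e} \<subseteq> C" "distinct [a, b, c, d, e]" "e = a + b + c + d"
proof -
  obtain z where z: "z \<in> C" using C by (metis card.empty ex_in_conv zero_neq_numeral)
  let ?D = "{x - y |x y. x \<in> C \<and> y \<in> C}"
  let ?T = "{P. P \<subseteq> C - {z} \<and> card P = 2}" and ?s = "\<lambda>P. \<Sum>P + z"
  have "inj_on ?s ?T"
  proof (rule inj_onI)
    fix P Q assume *: "P \<in> ?T" "Q \<in> ?T" "?s P = ?s Q"
    then obtain p q r s where "P = {p, q}" "Q = {r, s}" "p \<noteq> q" "r \<noteq> s"
      by (auto simp: card_2_iff)
    with * have "p + q = r + s" "{p, q, r, s} \<subseteq> C" by auto
    then show "P = Q" using sidonD[OF C(1)] \<open>P = _\<close> \<open>Q = _\<close> by auto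
  qed
  then have "card (?s ` ?T) = 78"
    using C z by (simp add: card_image n_subsets choose_two)
  moreover have "card ?D = 183"
    using C z by (subst card_differences) auto
  \<comment> \<open>Here 14 * 13 + 1 = 183, there are 78 pairs among 13 points, and 183 + 78 = 261
    exceeds 243.\<close>
  ultimately have "card ?D + card (?s ` ?T) > CARD('a)" using card by simp
  then have "?D \<inter> ?s ` ?T \<noteq> {}"
    by (metis (no_types, lifting) card_Un_disjoint card_mono finite finite_class.finite_UNIV
        linorder_not_less subset_UNIV)
  then obtain w where w: "w \<in> ?D" "w \<in> ?s ` ?T" by blast
  from w(1) obtain x y where xy: "x \<in> C" "y \<in> C" and "w = x - y" by blast
  moreover from w(2) obtain P where "P \<in> ?T" "w = ?s P" by blast
  ultimately have P: "P \<in> ?T" "x - y = ?s P" by blast+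
  then obtain u v where "P = {u, v}" "u \<noteq> v" by (auto simp: card_2_iff)
  with P have uv: "u \<in> C" "v \<in> C" "u \<noteq> z" "v \<noteq> z" "u \<noteq> v"
    and eq: "x - y = u + v + z" by auto
  have x: "x = y + u + v + z" using eq by (simp add: algebra_simps)
  have "x \<noteq> y" using sidon_sum_zeroD[OF C(1), of u v z] x uv z by (auto simp: add.assoc)
  \<comment> \<open>If \<open>y = p\<close>, then \<open>x = p + p + q + r\<close> turns into
    \<open>x + p = q + r\<close>, and \<open>p\<close> would be \<open>q\<close> or
    \<open>r\<close>. The variables \<open>p, q, r\<close> stand for any ordering of
    \<open>u, v, z\<close>.\<close>
  moreover have "y \<noteq> p" if "{p, q, r} = {u, v, z}" "p \<noteq> q" "p \<noteq> r" "x = y + p + q + r" for p q r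
  proof
    assume "y = p"
    then have "x + p = q + r" using that(4) by (simp add: exp3_simps add_ac)
    moreover have "{p, q, r} \<subseteq> C" unfolding that(1) using uv z by simp
    then have "p \<in> C" "q \<in> C" "r \<in> C" by simp_all
    ultimately show False using sidonD[OF C(1), of x p q r] that xy by blast
  qed
  from this[of u v z] this[of v u z] this[of z u v] have "y \<noteq> u" "y \<noteq> v" "y \<noteq> z"
    using uv x by (auto simp: add_ac)
  \<comment> \<open>If \<open>x = p\<close>, cancellation leaves the line relation
    \<open>y + q + r = 0\<close>, which forces \<open>q = r\<close>.\<close>
  moreover have "x \<noteq> p" if "{p, q, r} = {u, v, z}" "q \<noteq> r" "x = y + p + q + r" for p q r
  proof
    assume "x = p"
    then have "y + q + r = 0" using that(3) by (simp add: add_ac)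
    moreover have "{p, q, r} \<subseteq> C" unfolding that(1) using uv z by simp
    then have "p \<in> C" "q \<in> C" "r \<in> C" by simp_all
    ultimately show False using sidon_sum_zeroD[OF C(1), of y q r] that xy by blast
  qed
  from this[of u v z] this[of v u z] this[of z u v] have "x \<noteq> u" "x \<noteq> v" "x \<noteq> z"
    using uv x by (auto simp: add_ac)
  ultimately show ?thesis using that[of y u v z x] x xy uv z by auto
qed

section \<open>Coordinates\<close>

text \<open>The constructors stand for the scalars 0, 1 and -1. Coordinates are plain data so that
  the search can be evaluated by rewriting.\<close>

datatype trit = T0 | T1 | T2

lemma UNIV_trit: "(UNIV :: trit set) = {T0, T1, T2}"
  using trit.exhaust by auto

instance trit :: finite
  by standard (simp add: UNIV_trit)

fun tadd :: "trit \<Rightarrow> trit \<Rightarrow> trit" where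
  "tadd T0 y = y"
| "tadd T1 T0 = T1" | "tadd T1 T1 = T2" | "tadd T1 T2 = T0"
| "tadd T2 T0 = T2" | "tadd T2 T1 = T0" | "tadd T2 T2 = T1"

fun tsub :: "trit \<Rightarrow> trit \<Rightarrow> trit" where
  "tsub x T0 = x"
| "tsub T0 T1 = T2" | "tsub T1 T1 = T0" | "tsub T2 T1 = T1"
| "tsub T0 T2 = T1" | "tsub T1 T2 = T2" | "tsub T2 T2 = T0"

fun padd :: "trit list \<Rightarrow> trit list \<Rightarrow> trit list" where
  "padd (x # xs) (y # ys) = tadd x y # padd xs ys"
| "padd _ _ = []"

fun psub :: "trit list \<Rightarrow> trit list \<Rightarrow> trit list" where
  "psub (x # xs) (y # ys) = tsub x y # psub xs ys"
| "psub _ _ = []"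

fun smul :: "trit \<Rightarrow> 'a \<Rightarrow> 'a::ab_group_add" where
  "smul T0 v = 0"
| "smul T1 v = v"
| "smul T2 v = - v"

fun lincomb :: "'a list \<Rightarrow> trit list \<Rightarrow> 'a::ab_group_add" where
  "lincomb (v # vs) (t # ts) = smul t v + lincomb vs ts"
| "lincomb _ _ = 0"

lemma smul_tadd: "smul (tadd s t) v = smul s v + smul t (v::'a::ab_group_exp3)"
  by (cases s; cases t) (simp_all add: exp3_simps add_ac)

lemma smul_tsub: "smul (tsub s t) v = smul s v - smul t (v::'a::ab_group_exp3)"
  by (cases s; cases t) (simp_all add: exp3_simps add_ac)

lemma lincomb_padd:
  fixes vs :: "'a::ab_group_exp3 list"
  assumes "length s = length vs" "length t = length vs"
  shows "lincomb vs (padd s t) = lincomb vs s + lincomb vs t"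
  using assms
  by (induction vs arbitrary: s t) (auto simp: length_Suc_conv smul_tadd algebra_simps)

lemma lincomb_psub:
  fixes vs :: "'a::ab_group_exp3 list"
  assumes "length s = length vs" "length t = length vs"
  shows "lincomb vs (psub s t) = lincomb vs s - lincomb vs t"
  using assms
  by (induction vs arbitrary: s t) (auto simp: length_Suc_conv smul_tsub algebra_simps)

lemma length_padd: "length (padd s t) = min (length s) (length t)"
  by (induction s t rule: padd.induct) auto

lemma length_psub: "length (psub s t) = min (length s) (length t)"
  by (induction s t rule: psub.induct) auto

section \<open>Linear spans and independent lists\<close>

definition gen :: "'a list \<Rightarrow> 'a::ab_group_add set" where
  "gen vs = lincomb vs ` {ts. length ts = length vs}"

lemma gen_Nil [simp]: "gen [] = {0}"
  by (auto simp: gen_def)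

lemma gen_Cons: "gen (v # vs) = {smul t v + w |t w. w \<in> gen vs}"
proof (intro set_eqI iffI)
  fix x assume "x \<in> gen (v # vs)"
  then obtain ts where "x = lincomb (v # vs) ts" "length ts = Suc (length vs)"
    by (auto simp: gen_def)
  then show "x \<in> {smul t v + w |t w. w \<in> gen vs}"
    by (cases ts) (auto simp: gen_def)
next
  fix x assume "x \<in> {smul t v + w |t w. w \<in> gen vs}"
  then obtain t ts where "x = lincomb (v # vs) (t # ts)" "length ts = length vs"
    by (auto simp: gen_def)
  then show "x \<in> gen (v # vs)" unfolding gen_def by fastforce
qed

lemma smul_add_in_gen: "w \<in> gen vs \<Longrightarrow> smul t v + w \<in> gen (v # vs)"
  by (auto simp: gen_Cons)

lemma finite_trit_lists: "finite {ts :: trit list. length ts = n}"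
  using finite_lists_length_eq[of "UNIV :: trit set" n] by simp

lemma finite_gen [simp, intro]: "finite (gen vs)"
  unfolding gen_def by (intro finite_imageI finite_trit_lists)

lemma zero_in_gen [simp]: "0 \<in> gen vs"
  by (induction vs) (auto simp: gen_Cons intro: exI[of _ T0])

lemma gen_add:
  fixes vs :: "'a::ab_group_exp3 list"
  shows "x \<in> gen vs \<Longrightarrow> y \<in> gen vs \<Longrightarrow> x + y \<in> gen vs"
  by (auto simp: gen_def lincomb_padd[symmetric] length_padd)

lemma gen_diff:
  fixes vs :: "'a::ab_group_exp3 list"
  shows "x \<in> gen vs \<Longrightarrow> y \<in> gen vs \<Longrightarrow> x - y \<in> gen vs"
  by (auto simp: gen_def lincomb_psub[symmetric] length_psub)

lemma gen_minus:
  fixes vs :: "'a::ab_group_exp3 list"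
  shows "x \<in> gen vs \<Longrightarrow> - x \<in> gen vs"
  using gen_diff[of 0 vs x] by simp

lemma gen_smul:
  fixes vs :: "'a::ab_group_exp3 list"
  shows "x \<in> gen vs \<Longrightarrow> smul t x \<in> gen vs"
  by (cases t) (auto intro: gen_minus)

lemma gen_Cons_superset: "gen vs \<subseteq> gen (v # vs)"
  using smul_add_in_gen[where t = T0] by auto

lemma set_subset_gen: "set vs \<subseteq> gen vs"
proof (induction vs)
  case (Cons v vs)
  have "smul T1 v + 0 \<in> gen (v # vs)" by (rule smul_add_in_gen) simp
  with Cons gen_Cons_superset[of vs v] show ?case by auto
qed simp

lemma gen_minimal:
  fixes vs ws :: "'a::ab_group_exp3 list"
  assumes "set vs \<subseteq> gen ws"
  shows "gen vs \<subseteq> gen ws"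
  using assms by (induction vs) (auto simp: gen_Cons intro!: gen_add gen_smul)

fun indep :: "'a::ab_group_add list \<Rightarrow> bool" where
  "indep [] = True"
| "indep (v # vs) \<longleftrightarrow> v \<notin> gen vs \<and> indep vs"

lemma inj_on_lincomb:
  fixes vs :: "'a::ab_group_exp3 list"
  assumes "indep vs"
  shows "inj_on (lincomb vs) {ts. length ts = length vs}"
  using assms
proof (induction vs)
  case (Cons v vs)
  show ?case
  proof (rule inj_onI)
    fix x y
    assume *: "x \<in> {ts. length ts = length (v # vs)}" "y \<in> {ts. length ts = length (v # vs)}"
      and eq: "lincomb (v # vs) x = lincomb (v # vs) y"
    obtain s ss t ts where x: "x = s # ss" "length ss = length vs"
      and y: "y = t # ts" "length ts = length vs"
      using * by (auto simp: length_Suc_conv)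
    have "smul (tsub s t) v = lincomb vs ts - lincomb vs ss"
      using eq x y by (simp add: smul_tsub algebra_simps)
    also have "\<dots> \<in> gen vs" using x y by (intro gen_diff) (auto simp: gen_def)
    finally have in_gen: "smul (tsub s t) v \<in> gen vs" .
    \<comment> \<open>A nonzero coefficient is 1 or -1, so \<open>s\<close> differing from
      \<open>t\<close> would put \<open>v\<close> itself into the span of the tail.\<close>
    have "s = t"
    proof (rule ccontr)
      assume "s \<noteq> t"
      then have "v = smul (tsub s t) v \<or> v = - smul (tsub s t) v"
        by (cases s; cases t) auto
      then have "v \<in> gen vs" using in_gen gen_minus[OF in_gen] by metis
      then show False using Cons.prems by simp
    qed
    moreover from this have "ss = ts" using Cons eq x y by (auto simp: inj_on_def)
    ultimately show "x = y" using x y by simp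
  qed
qed (auto simp: inj_on_def)

lemma card_trit_lists: "card {ts :: trit list. length ts = n} = 3 ^ n"
proof -
  have "card (UNIV :: trit set) = 3" by (simp add: UNIV_trit)
  then show ?thesis using card_lists_length_eq[of "UNIV :: trit set" n] by simp
qed

lemma card_gen:
  fixes vs :: "'a::ab_group_exp3 list"
  shows "indep vs \<Longrightarrow> card (gen vs) = 3 ^ length vs"
  unfolding gen_def by (simp add: card_image inj_on_lincomb card_trit_lists)

lemma card_gen_le: "card (gen vs) \<le> 3 ^ length vs"
  using card_image_le[OF finite_trit_lists, of "lincomb vs" "length vs"]
  by (simp add: gen_def card_trit_lists)

text \<open>Steinitz exchange: the coefficient of \<open>v\<close> in \<open>u\<close> is 1 or -1,
  hence its own inverse, and the equation can be solved for \<open>v\<close>.\<close>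

lemma gen_exchange:
  fixes vs :: "'a::ab_group_exp3 list"
  assumes "u \<in> gen (v # vs)" "u \<notin> gen vs"
  shows "gen (v # vs) \<subseteq> gen (u # vs)"
proof (rule gen_minimal)
  obtain t w where u: "u = smul t v + w" "w \<in> gen vs" using assms(1) by (auto simp: gen_Cons)
  have "t \<noteq> T0" using u assms(2) by auto
  then have "smul t (u - w) = v" using u(1) by (cases t) (auto simp: algebra_simps)
  moreover have "u - w \<in> gen (u # vs)"
    using set_subset_gen[of "u # vs"] u(2) gen_Cons_superset[of vs u] by (intro gen_diff) auto
  ultimately have "v \<in> gen (u # vs)" by (metis gen_smul)
  then show "set (v # vs) \<subseteq> gen (u # vs)"
    using set_subset_gen[of vs] gen_Cons_superset[of vs u] by auto
qed

lemma gen_cong: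
  fixes vs ws :: "'a::ab_group_exp3 list"
  shows "set vs = set ws \<Longrightarrow> gen vs = gen ws"
  using gen_minimal[of vs ws] gen_minimal[of ws vs] set_subset_gen by (metis subset_antisym)

lemma indep_exhausts:
  fixes vs :: "'a::{ab_group_exp3,finite} list"
  assumes "indep vs" "CARD('a) = 3 ^ length vs"
  shows "gen vs = UNIV"
  using assms card_gen[OF assms(1)] by (intro card_subset_eq) auto

lemma ex_indep_extension:
  fixes vs :: "'a::{ab_group_exp3,finite} list"
  assumes "3 ^ length vs < CARD('a)"
  obtains v where "v \<notin> gen vs"
  using assms card_gen_le[of vs] by (metis UNIV_eq_I linorder_not_less)

section \<open>Pigeonhole arguments on pencils and parallel classes\<close>

lemma card_le_of_cover4:
  assumes "finite P" "P \<subseteq> A \<union> B \<union> C \<union> D"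
  shows "card P \<le> card (P \<inter> A) + card (P \<inter> B) + card (P \<inter> C) + card (P \<inter> D)"
proof -
  have "P = (P \<inter> A) \<union> (P \<inter> B) \<union> (P \<inter> C) \<union> (P \<inter> D)" using assms(2) by auto
  then have "card P = card ((P \<inter> A) \<union> (P \<inter> B) \<union> (P \<inter> C) \<union> (P \<inter> D))" by simp
  also have "\<dots> \<le> card (P \<inter> A) + card (P \<inter> B) + card (P \<inter> C) + card (P \<inter> D)"
    by (meson add_mono card_Un_le le_refl order_trans)
  finally show ?thesis .
qed

text \<open>Modulo \<open>gen vs\<close> the space is a plane, covered by its four lines through the
  origin, with directions \<open>v\<close>, \<open>u\<close>, \<open>u + v\<close> and
  \<open>u - v\<close>. One of them receives three of the nine points. For a solid
  \<open>gen vs\<close> in dimension 5 these lines are the four hyperplanes through it.\<close>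

lemma ex_line_of_three:
  fixes vs :: "'a::{ab_group_exp3,finite} list"
  assumes vs: "indep vs" "CARD('a) = 9 * 3 ^ length vs" and P: "card P \<ge> 9"
  obtains v where "card {p \<in> P. p - a \<in> gen (v # vs)} \<ge> 3"
proof -
  have "3 ^ length vs < CARD('a)" using vs(2) by simp
  then obtain v where v: "v \<notin> gen vs" by (rule ex_indep_extension)
  have "3 ^ length (v # vs) < CARD('a)" using vs(2) by simp
  then obtain u where u: "u \<notin> gen (v # vs)" by (rule ex_indep_extension)
  have univ: "gen (u # v # vs) = UNIV"
    using u v vs by (intro indep_exhausts) auto
  define X where "X w = {p. p - a \<in> gen (w # vs)}" for w
  have "p \<in> X v \<union> X u \<union> X (u + v) \<union> X (u - v)" for p
  proof -
    have "p - a \<in> gen (u # v # vs)" using univ by simp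
    then obtain s t w where eq: "p - a = smul s u + (smul t v + w)" and w: "w \<in> gen vs"
      by (auto simp: gen_Cons)
    have *: "\<And>t x. p - a = smul t x + w \<Longrightarrow> p \<in> X x"
      using w by (simp add: X_def smul_add_in_gen)
    consider "s = T0" | "t = T0" | "s \<noteq> T0" "t \<noteq> T0" "s = t" | "s \<noteq> T0" "t \<noteq> T0" "s \<noteq> t" by blast
    then show ?thesis
    proof cases
      case 1 then show ?thesis using *[of t v] eq by simp
    next
      case 2 then show ?thesis using *[of s u] eq by simp
    next
      case 3 then have "p - a = smul s (u + v) + w" using eq by (cases s) (auto simp: algebra_simps)
      then show ?thesis using * by blast
    next
      case 4 then have "p - a = smul s (u - v) + w" using eq by (cases s; cases t) (auto simp: algebra_simps)
      then show ?thesis using * by blast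
    qed
  qed
  then have "P \<subseteq> X v \<union> X u \<union> X (u + v) \<union> X (u - v)" by blast
  from card_le_of_cover4[OF finite this]
  have "card (P \<inter> X v) \<ge> 3 \<or> card (P \<inter> X u) \<ge> 3 \<or> card (P \<inter> X (u + v)) \<ge> 3 \<or> card (P \<inter> X (u - v)) \<ge> 3"
    using P by linarith
  moreover have "P \<inter> X w = {p \<in> P. p - a \<in> gen (w # vs)}" for w by (auto simp: X_def)
  ultimately show ?thesis using that by metis
qed

text \<open>The span of \<open>v # vs\<close> consists of three cosets of \<open>gen vs\<close>, and
  \<open>out\<close> forbids one of them, so two of three points share a coset.\<close>

lemma ex_two_in_coset:
  fixes vs :: "'a::ab_group_exp3 list"
  assumes card: "card {p \<in> P. p - a \<in> gen (v # vs)} \<ge> 3"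
    and out: "\<And>p. p \<in> P \<Longrightarrow> p - a \<notin> gen vs"
  obtains f g h where "{f, g, h} \<subseteq> P" "distinct [f, g, h]" "g - f \<in> gen vs"
    "g - a \<in> gen ((f - a) # vs)" "h - a \<in> gen ((f - a) # vs)"
proof -
  let ?Q = "{p \<in> P. p - a \<in> gen (v # vs)}"
  obtain R where R: "R \<subseteq> ?Q" "card R = 3" using card by (meson obtain_subset_with_card_n)
  then obtain x y z where xyz: "R = {x, y, z}" "distinct [x, y, z]"
    by (auto simp: card_3_iff)
  have level: "p - a - v \<in> gen vs \<or> p - a + v \<in> gen vs" if p: "p \<in> ?Q" for p
  proof -
    obtain t w where "p - a = smul t v + w" "w \<in> gen vs" using p by (auto simp: gen_Cons)
    moreover have "p - a \<notin> gen vs" using p out by blast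
    ultimately show ?thesis by (cases t) auto
  qed
  have same: "q - p \<in> gen vs" if "p - a + u \<in> gen vs" "q - a + u \<in> gen vs" for p q u
    using gen_diff[OF that(2,1)] by simp
  have same': "q - p \<in> gen vs" if "p - a - u \<in> gen vs" "q - a - u \<in> gen vs" for p q u
    using gen_diff[OF that(2,1)] by simp
  have "\<exists>f g h. R = {f, g, h} \<and> distinct [f, g, h] \<and> g - f \<in> gen vs"
  proof -
    have "y - x \<in> gen vs \<or> z - x \<in> gen vs \<or> z - y \<in> gen vs"
      using level[of x] level[of y] level[of z] R xyz same same' by blast
    moreover have "R = {x, z, y}" "R = {y, z, x}" using xyz by auto
    ultimately show ?thesis using xyz by (metis distinct_length_2_or_more distinct_singleton)
  qed
  then obtain f g h where fgh: "R = {f, g, h}" "distinct [f, g, h]" "g - f \<in> gen vs" by blast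
  \<comment> \<open>By exchange, \<open>f - a\<close> replaces the auxiliary direction
    \<open>v\<close>, so the hyperplane is described by points of \<open>P\<close> only.\<close>
  have "gen (v # vs) \<subseteq> gen ((f - a) # vs)"
    using R fgh out by (intro gen_exchange) auto
  then show ?thesis using that[of f g h] R fgh by blast
qed

text \<open>Outside the hyperplane through \<open>a\<close> there are only two parallel ones, and
  one of them receives three of five points. A point \<open>k\<close> of \<open>P\<close> on it
  serves as its name.\<close>

lemma ex_level_of_three:
  fixes vs :: "'a::{ab_group_exp3,finite} list"
  assumes vs: "indep vs" "CARD('a) = 3 * 3 ^ length vs"
    and P: "card P \<ge> 5" and out: "\<And>p. p \<in> P \<Longrightarrow> p - a \<notin> gen vs"
  obtains k where "k \<in> P" "card {p \<in> P. p - k \<in> gen vs} \<ge> 3"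
proof -
  have "3 ^ length vs < CARD('a)" using vs(2) by simp
  then obtain v where v: "v \<notin> gen vs" by (rule ex_indep_extension)
  have univ: "gen (v # vs) = UNIV" using v vs by (intro indep_exhausts) auto
  define X where "X t = {p \<in> P. p - a - smul t v \<in> gen vs}" for t
  have "P \<subseteq> X T1 \<union> X T2"
  proof
    fix p assume p: "p \<in> P"
    have "p - a \<in> gen (v # vs)" using univ by simp
    then obtain t w where "p - a = smul t v + w" "w \<in> gen vs" by (auto simp: gen_Cons)
    then show "p \<in> X T1 \<union> X T2" using out[OF p] p by (cases t) (auto simp: X_def)
  qed
  then have "P = X T1 \<union> X T2" by (auto simp: X_def)
  then have "card P \<le> card (X T1) + card (X T2)" by (metis card_Un_le)
  then have "card (X T1) \<ge> 3 \<or> card (X T2) \<ge> 3" using P by linarith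
  then obtain t where t: "card (X t) \<ge> 3" by blast
  then obtain k where k: "k \<in> X t" by (metis card.empty ex_in_conv not_numeral_le_zero)
  have "X t \<subseteq> {p \<in> P. p - k \<in> gen vs}"
  proof
    fix p assume p: "p \<in> X t"
    have "(p - a - smul t v) - (k - a - smul t v) \<in> gen vs"
      using p k unfolding X_def by (blast intro: gen_diff)
    then show "p \<in> {p \<in> P. p - k \<in> gen vs}" using p by (simp add: X_def)
  qed
  then have "card (X t) \<le> card {p \<in> P. p - k \<in> gen vs}" by (intro card_mono) auto
  then show ?thesis using that[of k] t k by (auto simp: X_def)
qed

section \<open>Exhaustive search\<close>

text \<open>Ternary branching on coordinates makes a lookup during the search take time proportional
  to the dimension.\<close>

datatype trie = Empty | Leaf | Node trie trie trie

fun ins :: "trit list \<Rightarrow> trie \<Rightarrow> trie" where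
  "ins [] _ = Leaf"
| "ins (T0 # ts) (Node a b c) = Node (ins ts a) b c"
| "ins (T1 # ts) (Node a b c) = Node a (ins ts b) c"
| "ins (T2 # ts) (Node a b c) = Node a b (ins ts c)"
| "ins (T0 # ts) _ = Node (ins ts Empty) Empty Empty"
| "ins (T1 # ts) _ = Node Empty (ins ts Empty) Empty"
| "ins (T2 # ts) _ = Node Empty Empty (ins ts Empty)"

fun mem :: "trit list \<Rightarrow> trie \<Rightarrow> bool" where
  "mem [] Leaf = True"
| "mem (T0 # ts) (Node a b c) = mem ts a"
| "mem (T1 # ts) (Node a b c) = mem ts b"
| "mem (T2 # ts) (Node a b c) = mem ts c"
| "mem _ _ = False"

lemma mem_Empty [simp]: "\<not> mem x Empty"
  by (cases "(x, Empty)" rule: mem.cases) auto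

text \<open>Pruning discards a point only after a successful lookup, so its soundness rests on every
  hit having really been inserted.\<close>

lemma mem_insD: "mem x (ins y t) \<Longrightarrow> x = y \<or> mem x t"
  by (induction y t arbitrary: x rule: ins.induct; erule mem.elims(2); auto)

fun ins_diffs :: "trit list \<Rightarrow> trit list list \<Rightarrow> trie \<Rightarrow> trie" where
  "ins_diffs c [] D = D"
| "ins_diffs c (s # S) D = ins_diffs c S (ins (psub c s) (ins (psub s c) D))"

fun ins_sums :: "trit list \<Rightarrow> trit list list \<Rightarrow> trie \<Rightarrow> trie" where
  "ins_sums c [] M = M"
| "ins_sums c (s # S) M = ins_sums c S (ins (padd c s) M)"

lemma mem_ins_diffsD:
  "mem x (ins_diffs c S D) \<Longrightarrow> mem x D \<or> (\<exists>s\<in>set S. x = psub c s \<or> x = psub s c)"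
  by (induction c S D rule: ins_diffs.induct) (auto dest!: mem_insD)

lemma mem_ins_sumsD:
  "mem x (ins_sums c S M) \<Longrightarrow> mem x M \<or> (\<exists>s\<in>set S. x = padd c s)"
  by (induction c S M rule: ins_sums.induct) (auto dest!: mem_insD)

text \<open>A state consists of the points chosen so far, their differences and their sums.\<close>

type_synonym state = "trit list list \<times> trie \<times> trie"

fun push :: "trit list \<Rightarrow> state \<Rightarrow> state" where
  "push c (S, D, M) = (c # S, ins_diffs c S D, ins_sums c (c # S) M)"

text \<open>The test runs before \<open>c\<close> is pushed: a relation among \<open>x\<close>,
  \<open>c\<close> and older points \<open>s\<close>, \<open>t\<close> reads
  \<open>x - c = s - t\<close> or \<open>x + c = s + t\<close>. The stored sums include doubles, so
  lines are caught as \<open>x + c = s + s\<close>; the relation \<open>x + s = c + c\<close>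
  describes the same line.\<close>

fun no_clash :: "state \<Rightarrow> trit list \<Rightarrow> trit list \<Rightarrow> bool" where
  "no_clash (S, D, M) c x \<longleftrightarrow> \<not> mem (psub x c) D \<and> \<not> mem (padd x c) M"

definition sidon_lists :: "trit list set \<Rightarrow> bool" where
  "sidon_lists X \<longleftrightarrow> (\<forall>x\<in>X. \<forall>y\<in>X. \<forall>u\<in>X. \<forall>v\<in>X.
     (psub x y = psub u v \<longrightarrow> x = y \<or> x = u) \<and> (padd x y = padd u v \<longrightarrow> x = u \<or> x = v))"

fun state_in :: "trit list set \<Rightarrow> state \<Rightarrow> bool" where
  "state_in X (S, D, M) \<longleftrightarrow> set S \<subseteq> X \<and>
     (\<forall>v. mem v D \<longrightarrow> (\<exists>s\<in>set S. \<exists>t\<in>set S. v = psub s t)) \<and>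
     (\<forall>v. mem v M \<longrightarrow> (\<exists>s\<in>set S. \<exists>t\<in>set S. v = padd s t))"

lemma state_in_push:
  assumes "state_in X st" "c \<in> X"
  shows "state_in X (push c st)"
proof -
  obtain S D M where st: "st = (S, D, M)" by (cases st) auto
  have S: "set S \<subseteq> X" and D: "\<And>v. mem v D \<Longrightarrow> \<exists>s\<in>set S. \<exists>t\<in>set S. v = psub s t"
    and M: "\<And>v. mem v M \<Longrightarrow> \<exists>s\<in>set S. \<exists>t\<in>set S. v = padd s t"
    using assms(1) by (auto simp: st)
  have "\<exists>s\<in>set (c # S). \<exists>t\<in>set (c # S). v = psub s t" if "mem v (ins_diffs c S D)" for v
    using mem_ins_diffsD[OF that] D[of v] by (meson list.set_intros)
  moreover have "\<exists>s\<in>set (c # S). \<exists>t\<in>set (c # S). v = padd s t"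
    if "mem v (ins_sums c (c # S) M)" for v
    using mem_ins_sumsD[OF that] M[of v] by (meson list.set_intros)
  ultimately show ?thesis using S assms(2) by (simp only: st push.simps state_in.simps) simp
qed

lemma fst_push [simp]: "fst (push c st) = c # fst st"
  by (cases st) auto

lemma sidon_listsD:
  assumes "sidon_lists X" "x \<in> X" "y \<in> X" "u \<in> X" "v \<in> X"
  shows "psub x y = psub u v \<Longrightarrow> x = y \<or> x = u" "padd x y = padd u v \<Longrightarrow> x = u \<or> x = v"
  using assms unfolding sidon_lists_def by blast+

lemma no_clashI:
  assumes "state_in X st" "sidon_lists X" "c \<in> X" "x \<in> X" "x \<notin> set (fst st)" "x \<noteq> c"
  shows "no_clash st c x"
proof -
  obtain S D M where st: "st = (S, D, M)" by (cases st) auto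
  have S: "set S \<subseteq> X" and D: "\<And>v. mem v D \<Longrightarrow> \<exists>s\<in>set S. \<exists>t\<in>set S. v = psub s t"
    and M: "\<And>v. mem v M \<Longrightarrow> \<exists>s\<in>set S. \<exists>t\<in>set S. v = padd s t"
    using assms(1) by (auto simp: st)
  have x: "x \<notin> set S" using assms(5) by (simp add: st)
  have "\<not> mem (psub x c) D"
  proof
    assume "mem (psub x c) D"
    then obtain s t where st: "s \<in> set S" "t \<in> set S" "psub x c = psub s t" using D by blast
    then have "s \<in> X" "t \<in> X" using S by auto
    from sidon_listsD(1)[OF assms(2,4,3) this st(3)] show False using st x assms(6) by auto
  qed
  moreover have "\<not> mem (padd x c) M"
  proof
    assume "mem (padd x c) M"
    then obtain s t where st: "s \<in> set S" "t \<in> set S" "padd x c = padd s t" using M by blast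
    then have "s \<in> X" "t \<in> X" using S by auto
    from sidon_listsD(2)[OF assms(2,4,3) this st(3)] show False using st x by auto
  qed
  ultimately show ?thesis by (simp add: st)
qed

text \<open>Pruning never loses a point of the hypothetical full set \<open>X\<close>, so counts of
  surviving members of \<open>X\<close> stay exact.\<close>

lemma filter_no_clash:
  assumes "state_in X st" "sidon_lists X" "c \<in> X" "set xs \<inter> insert c (set (fst st)) = {}"
  shows "filter (\<lambda>x. x \<in> X) (filter (no_clash st c) xs) = filter (\<lambda>x. x \<in> X) xs"
  using assms no_clashI[OF assms(1-3)] by (auto intro!: filter_cong)

text \<open>\<open>noext j n st cs rs\<close>: the chosen points cannot be extended by \<open>n\<close> candidates from \<open>cs @ rs\<close>,
  at least \<open>j\<close> of them from \<open>cs\<close>.\<close>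

function noext :: "nat \<Rightarrow> nat \<Rightarrow> state \<Rightarrow> trit list list \<Rightarrow> trit list list \<Rightarrow> bool" where
  "noext j n st cs rs =
    (if length cs < j \<or> length cs + length rs < n then True
     else if n = 0 then False
     else (case cs of
        [] \<Rightarrow> rs \<noteq> [] \<and> noext 0 n st rs []
      | c # cs' \<Rightarrow> noext j n st cs' rs \<and>
          noext (j - 1) (n - 1) (push c st) (filter (no_clash st c) cs') (filter (no_clash st c) rs)))"
  by auto
termination
  \<comment> \<open>When \<open>cs\<close> is used up, the nonempty \<open>rs\<close> moves into its
    place; the weight 2 makes the measure drop there.\<close>
  by (relation "Wellfounded.measure (\<lambda>(j, n, st, cs, rs). 2 * length rs + length cs)")
    (auto simp: less_Suc_eq_le intro!: add_mono)

declare noext.simps [simp del]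

text \<open>\<open>X\<close> is a putative completion. The induction follows the branch that agrees
  with it: skip \<open>c\<close> when \<open>c\<close> is not in \<open>X\<close>, push it
  otherwise.\<close>

lemma noext_sound:
  assumes "noext j n st cs rs" "sidon_lists X" "state_in X st"
    "distinct (cs @ rs)" "set (cs @ rs) \<inter> set (fst st) = {}"
    "j \<le> length (filter (\<lambda>x. x \<in> X) cs)"
  shows "length (filter (\<lambda>x. x \<in> X) (cs @ rs)) < n"
  using assms
proof (induction j n st cs rs rule: noext.induct)
  case (1 j n st cs rs)
  let ?f = "filter (\<lambda>x. x \<in> X)"
  have le: "length (?f cs) \<le> length cs" "length (?f rs) \<le> length rs" by simp_all
  then have "j \<le> length cs" using "1.prems"(6) by linarith
  then consider "length cs + length rs < n" |
    "\<not> (length cs < j \<or> length cs + length rs < n)" "n \<noteq> 0"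
    using "1.prems"(1) by (subst (asm) noext.simps) (auto split: if_splits)
  then show ?case
  proof cases
    case 1
    with add_mono[OF le] show ?thesis unfolding filter_append length_append by (rule le_less_trans)
  next
    case 2
    show ?thesis
    proof (cases cs)
      case Nil
      have "noext 0 n st rs []"
        using "1.prems"(1) 2 Nil by (subst (asm) noext.simps) auto
      then show ?thesis using "1.IH"(1)[OF 2 Nil] "1.prems" Nil by auto
    next
      case (Cons c cs')
      have *: "noext j n st cs' rs" "noext (j - 1) (n - 1) (push c st)
          (filter (no_clash st c) cs') (filter (no_clash st c) rs)"
        using "1.prems"(1) 2 Cons by (subst (asm) noext.simps; auto)+
      show ?thesis
      proof (cases "c \<in> X")
        case False
        then show ?thesis using "1.IH"(2)[OF 2 Cons *(1)] "1.prems" Cons by auto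
      next
        case True
        have f: "?f (filter (no_clash st c) cs') = ?f cs'" "?f (filter (no_clash st c) rs) = ?f rs"
          using "1.prems" Cons True by (auto intro!: filter_no_clash simp del: filter_filter)
        have "length (?f (filter (no_clash st c) cs' @ filter (no_clash st c) rs)) < n - 1"
          using "1.prems" Cons True
          by (intro "1.IH"(3)[OF 2 Cons *(2)]) (auto simp del: filter_filter simp: f state_in_push)
        then show ?thesis using True Cons by (simp del: filter_filter add: f)
      qed
    qed
  qed
qed

fun pushes :: "trit list list \<Rightarrow> state \<Rightarrow> trit list list \<Rightarrow> trit list list
    \<Rightarrow> state \<times> trit list list \<times> trit list list" where
  "pushes [] st cs rs = (st, cs, rs)"
| "pushes (b # bs) st cs rs =
    pushes bs (push b st) (filter (no_clash st b) cs) (filter (no_clash st b) rs)"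

lemma pushes_invariant:
  assumes "pushes bs st cs rs = (st', cs', rs')" "sidon_lists X" "state_in X st" "set bs \<subseteq> X"
    "set (cs @ rs) \<inter> (set bs \<union> set (fst st)) = {}" "distinct (cs @ rs)"
  shows "state_in X st' \<and> set (fst st') = set bs \<union> set (fst st) \<and>
    set cs' \<subseteq> set cs \<and> set rs' \<subseteq> set rs \<and> distinct (cs' @ rs') \<and>
    filter (\<lambda>x. x \<in> X) cs' = filter (\<lambda>x. x \<in> X) cs \<and>
    filter (\<lambda>x. x \<in> X) rs' = filter (\<lambda>x. x \<in> X) rs"
  using assms
proof (induction bs st cs rs rule: pushes.induct)
  case (2 b bs st cs rs)
  let ?f = "filter (\<lambda>x. x \<in> X)"
  have f: "?f (filter (no_clash st b) cs) = ?f cs" "?f (filter (no_clash st b) rs) = ?f rs"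
    using "2.prems" by (auto intro!: filter_no_clash simp del: filter_filter)
  have "state_in X (push b st)" using "2.prems" by (auto intro: state_in_push)
  then have "state_in X st' \<and> set (fst st') = set bs \<union> set (fst (push b st)) \<and>
      set cs' \<subseteq> set (filter (no_clash st b) cs) \<and> set rs' \<subseteq> set (filter (no_clash st b) rs) \<and>
      distinct (cs' @ rs') \<and> ?f cs' = ?f (filter (no_clash st b) cs) \<and>
      ?f rs' = ?f (filter (no_clash st b) rs)"
    using "2.prems" by (intro "2.IH") auto
  then show ?case using f by (auto simp del: filter_filter)
qed auto

section \<open>The configuration of eight points and its completions\<close>

text \<open>Coordinates refer to the origin \<open>a\<close> and the vectors \<open>k - a, f - a, d - a, c - a, b - a\<close>, in this
  order: the entries of \<open>base\<close> are \<open>a, b, c, d, e, f, g, k\<close>, and the head of a list selects the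
  parallel of \<open>H\<close>.\<close>

definition base :: "trit list list" where
  "base = [[T0,T0,T0,T0,T0], [T0,T0,T0,T0,T1], [T0,T0,T0,T1,T0], [T0,T0,T1,T0,T0],
     [T0,T0,T1,T1,T1], [T0,T1,T0,T0,T0], [T0,T1,T2,T2,T1], [T1,T0,T0,T0,T0]]"

definition non_base :: "trit list \<Rightarrow> trit list list" where
  "non_base ts = filter (\<lambda>x. x \<notin> set base) (concat (map (\<lambda>t. map (Cons t) (List.n_lists 4 [T0, T1, T2])) ts))"

text \<open>\<open>h\<close> is a ninth point inside \<open>H\<close>, so 14 - 9 = 5 points are
  missing. The parallel of \<open>H\<close> at level \<open>T1\<close> holds three points including
  \<open>k\<close>, hence at least 2 of the missing ones.\<close>

definition search_fails :: bool where
  "search_fails \<longleftrightarrow>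
    (case pushes base ([], Empty, Empty) (non_base [T1]) (non_base [T0, T2]) of (st, cs, rs) \<Rightarrow>
      \<forall>h\<in>set (filter (\<lambda>h. hd h = T0) rs).
        noext 2 5 (push h st) (filter (no_clash st h) cs) (filter (no_clash st h) (remove1 h rs)))"

lemma search_fails: search_fails
  by code_simp

lemma set_non_base: "set (non_base ts) = {x. length x = 5 \<and> hd x \<in> set ts} - set base"
proof -
  have "set [T0, T1, T2] = UNIV" by (simp add: UNIV_trit)
  then have "set (List.n_lists 4 [T0, T1, T2]) = {x. length x = 4}"
    unfolding set_n_lists by simp
  then show ?thesis
    by (auto simp: non_base_def image_iff length_Suc_conv[of _ 4, simplified] simp del: set_simps)
qed

lemma distinct_non_base: "distinct ts \<Longrightarrow> distinct (non_base ts)"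
  unfolding non_base_def
  by (induction ts) (auto simp: distinct_map distinct_n_lists)

text \<open>Passing from coordinates to points is injective and affine, so it carries relations
  between lists to relations in \<open>C\<close>.\<close>

lemma sidon_lists_coordinates:
  fixes C :: "'a::ab_group_exp3 set"
  assumes C: "sidon C" and vs: "indep vs"
  shows "sidon_lists {ts. length ts = length vs \<and> a + lincomb vs ts \<in> C}" (is "sidon_lists ?X")
  unfolding sidon_lists_def
proof (intro ballI conjI impI)
  let ?p = "\<lambda>x. a + lincomb vs x"
  fix x y u v assume *: "x \<in> ?X" "y \<in> ?X" "u \<in> ?X" "v \<in> ?X"
  have inj: "s = t" if "s \<in> ?X" "t \<in> ?X" "?p s = ?p t" for s t
    using inj_onD[OF inj_on_lincomb[OF vs], of s t] that by simp
  {
    assume "psub x y = psub u v"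
    then have "lincomb vs (psub x y) = lincomb vs (psub u v)" by simp
    then have "?p x - ?p y = ?p u - ?p v"
      using * by (simp add: lincomb_psub)
    from sidon_diffD[OF C this] show "x = y \<or> x = u" using * inj by blast
  next
    assume "padd x y = padd u v"
    then have "lincomb vs (padd x y) = lincomb vs (padd u v)" by simp
    then have "?p x + ?p y = ?p u + ?p v"
      using * by (simp add: lincomb_padd algebra_simps)
    from sidonD[OF C this] show "x = u \<or> x = v" using * inj by blast
  }
qed

lemma sidon_lists_extending_base:
  assumes X: "sidon_lists X" "X \<subseteq> {x. length x = 5}" "set base \<subseteq> X"
    and h: "h \<in> X - set base" "hd h = T0"
    and level: "card {x \<in> X. hd x = T1} \<ge> 3"
  shows "card X < 14"
proof -
  let ?f = "filter (\<lambda>x. x \<in> X)"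
  obtain st cs rs where run: "pushes base ([], Empty, Empty) (non_base [T1]) (non_base [T0, T2]) = (st, cs, rs)"
    by (cases "pushes base ([], Empty, Empty) (non_base [T1]) (non_base [T0, T2])") auto
  have inv: "state_in X st \<and> set (fst st) = set base \<and> set cs \<subseteq> set (non_base [T1]) \<and>
      set rs \<subseteq> set (non_base [T0, T2]) \<and> distinct (cs @ rs) \<and>
      ?f cs = ?f (non_base [T1]) \<and> ?f rs = ?f (non_base [T0, T2])"
  proof -
    have "state_in X ([], Empty, Empty)" by simp
    moreover have "set (non_base [T1] @ non_base [T0, T2]) \<inter> (set base \<union> set (fst ([], Empty, Empty))) = {}"
      by (auto simp: set_non_base)
    moreover have "distinct (non_base [T1] @ non_base [T0, T2])"
      by (auto simp: distinct_non_base set_non_base)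
    ultimately show ?thesis using pushes_invariant[OF run X(1) _ X(3)] by simp
  qed
  have "set (?f (non_base [T1])) = {x \<in> X. hd x = T1} - {[T1,T0,T0,T0,T0]}"
    using X(2) by (auto simp: set_non_base base_def)
  then have "length (?f (non_base [T1])) = card ({x \<in> X. hd x = T1} - {[T1,T0,T0,T0,T0]})"
    by (metis distinct_card distinct_filter distinct_non_base distinct_singleton)
  also have "\<dots> \<ge> 2" using level by (auto simp: card_Diff_singleton_if)
  finally have j: "2 \<le> length (?f cs)" using inv by simp
  have "set (?f (non_base [T1] @ non_base [T0, T2])) = X - set base"
    using X(2) by (auto simp: set_non_base intro: trit.exhaust)
  moreover have "distinct (?f (non_base [T1] @ non_base [T0, T2]))"
    by (auto simp: distinct_non_base set_non_base)
  ultimately have "length (?f (non_base [T1] @ non_base [T0, T2])) = card (X - set base)"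
    by (metis distinct_card)
  also have "\<dots> = card X - 8"
    using X(3) by (subst card_Diff_subset) (auto simp: base_def)
  finally have n: "length (?f cs) + length (?f rs) = card X - 8" using inv by simp
  have "h \<in> set (?f (non_base [T0, T2]))" using h X(2) by (auto simp: set_non_base)
  then have "h \<in> set (?f rs)" using inv by metis
  then have h_rs: "h \<in> set rs" by simp
  have h_cs: "h \<notin> set cs" using inv h_rs by auto
  have disj: "set (cs @ rs) \<inter> set base = {}" using inv by (auto simp: set_non_base)
  have "set cs \<inter> insert h (set (fst st)) = {}" "set (remove1 h rs) \<inter> insert h (set (fst st)) = {}"
    using inv h_cs disj by (auto simp: set_remove1_eq)
  then have f: "?f (filter (no_clash st h) cs) = ?f cs"
    "?f (filter (no_clash st h) (remove1 h rs)) = ?f (remove1 h rs)"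
    using inv X(1) h by (blast intro: filter_no_clash)+
  have "noext 2 5 (push h st) (filter (no_clash st h) cs) (filter (no_clash st h) (remove1 h rs))"
    using search_fails run h_rs h(2) by (simp add: search_fails_def)
  then have "length (?f (filter (no_clash st h) cs @ filter (no_clash st h) (remove1 h rs))) < 5"
  proof (rule noext_sound[OF _ X(1)])
    show "state_in X (push h st)" using inv h by (simp add: state_in_push)
    show "distinct (filter (no_clash st h) cs @ filter (no_clash st h) (remove1 h rs))"
      using inv by (auto simp: set_remove1_eq)
    show "set (filter (no_clash st h) cs @ filter (no_clash st h) (remove1 h rs)) \<inter> set (fst (push h st)) = {}"
      using inv disj h_cs by (auto simp: set_remove1_eq)
    show "2 \<le> length (?f (filter (no_clash st h) cs))" using j f(1) by simp
  qed
  then have "length (?f cs) + length (?f (remove1 h rs)) < 5"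
    using f by (simp del: filter_filter)
  \<comment> \<open>Eight base points, \<open>h\<close> and at most four others make at most
    13.\<close>
  moreover have "length (?f (remove1 h rs)) = length (?f rs) - 1"
    using h h_rs by (simp add: filter_remove1 length_remove1)
  ultimately show ?thesis using n by linarith
qed

lemma sidon_configuration_card:
  fixes C :: "'a::{ab_group_exp3,finite} set"
  assumes C: "sidon C" and card: "CARD('a) = 243"
    and vs: "vs = [k - a, f - a, d - a, c - a, b - a]" "indep vs"
    and in_C: "{a, b, c, d, f, k, a + b + c + d, f + (a + b - c - d)} \<subseteq> C"
    and h: "h \<in> C - {a, b, c, d, f, a + b + c + d, f + (a + b - c - d)}" "h - a \<in> gen (tl vs)"
    and level: "card {p \<in> C. p - k \<in> gen (tl vs)} \<ge> 3"
  shows "card C < 14"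
proof -
  let ?p = "\<lambda>ts. a + lincomb vs ts"
  define X where "X = {ts. length ts = length vs \<and> ?p ts \<in> C}"
  have inj: "inj_on ?p {ts. length ts = length vs}"
    using inj_on_lincomb[OF vs(2)] by (auto simp: inj_on_def)
  have "gen vs = UNIV" using vs card by (intro indep_exhausts) auto
  then have surj: "\<exists>ts. length ts = length vs \<and> ?p ts = x" for x
  proof -
    have "x - a \<in> gen vs" using \<open>gen vs = UNIV\<close> by simp
    then obtain ts where "length ts = length vs" "x - a = lincomb vs ts" by (auto simp: gen_def)
    then show ?thesis by (metis add.commute diff_add_cancel)
  qed
  have "?p ` X = C" using surj by (auto simp: X_def) (metis (mono_tags, lifting) image_eqI mem_Collect_eq)
  moreover have "inj_on ?p X" by (rule inj_on_subset[OF inj]) (auto simp: X_def)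
  ultimately have cardX: "card X = card C" by (metis card_image)
  \<comment> \<open>Since \<open>a + a + a = 0\<close>, the point \<open>a + b + c + d\<close> has
    coordinates 1, 1, 1 in the last three places. For \<open>g\<close>, use
    \<open>a + b - c - d = (b - a) - (c - a) - (d - a)\<close>.\<close>
  have base: "set base \<subseteq> X"
    using in_C by (auto simp: X_def base_def vs(1) algebra_simps exp3_simps)
  obtain hs where "length hs = length (tl vs)" "h - a = lincomb (tl vs) hs"
    using h(2) unfolding gen_def by blast
  then have hs: "length hs = 4" "h = a + lincomb (tl vs) hs"
    using vs(1) by (simp_all add: algebra_simps)
  have "T0 # hs \<in> X" using h(1) hs vs(1) by (simp add: X_def)
  \<comment> \<open>The head \<open>T0\<close> separates \<open>h\<close> from \<open>k\<close>,
    whose head coordinate is \<open>T1\<close>; the hypothesis on \<open>h\<close> covers the other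
    seven.\<close>
  moreover have "T0 # hs \<notin> set base"
    using h(1) hs(2) vs(1) by (auto simp: base_def algebra_simps exp3_simps)
  ultimately have hX: "T0 # hs \<in> X - set base" by simp
  have "{p \<in> C. p - k \<in> gen (tl vs)} \<subseteq> ?p ` {x \<in> X. hd x = T1}"
  proof
    fix p assume p: "p \<in> {p \<in> C. p - k \<in> gen (tl vs)}"
    then obtain ts where ts: "length ts = length (tl vs)" "p - k = lincomb (tl vs) ts"
      unfolding gen_def by blast
    then have "length ts = 4" "p = ?p (T1 # ts)" using vs(1) by (simp_all add: algebra_simps)
    moreover have "T1 # ts \<in> {x \<in> X. hd x = T1}"
      using \<open>p = _\<close> p \<open>length ts = 4\<close> vs(1) by (simp add: X_def)
    ultimately show "p \<in> ?p ` {x \<in> X. hd x = T1}" by blast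
  qed
  then have "card {p \<in> C. p - k \<in> gen (tl vs)} \<le> card {x \<in> X. hd x = T1}"
    by (rule surj_card_le[rotated]) (simp add: X_def finite_trit_lists)
  with level have "card {x \<in> X. hd x = T1} \<ge> 3" by linarith
  moreover have "sidon_lists X" unfolding X_def using C vs(2) by (rule sidon_lists_coordinates)
  moreover have "X \<subseteq> {x. length x = 5}" by (auto simp: X_def vs(1))
  ultimately show ?thesis
    using sidon_lists_extending_base[OF _ _ base hX] cardX by simp
qed

section \<open>The upper bound\<close>

text \<open>The plane through \<open>a, b, c\<close> has nine points: these three, three that
  complete a line with two of them, and three that complete a parallelogram. The Sidon property
  keeps \<open>d\<close> away from all nine.\<close>

lemma indep_sidon4:
  fixes C :: "'a::ab_group_exp3 set"
  assumes C: "sidon C" "{a, b, c, d} \<subseteq> C" "distinct [a, b, c, d]"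
  shows "indep [d - a, c - a, b - a]"
proof -
  have no_line: "x + y + z \<noteq> 0" if "x \<noteq> y" "{x, y, z} \<subseteq> C" for x y z
    using sidon_sum_zeroD[OF C(1), of x y z] that by auto
  have no_plane: "x + y \<noteq> z + w" if "x \<noteq> z" "x \<noteq> w" "{x, y, z, w} \<subseteq> C" for x y z w
    using sidonD[OF C(1), of x y z w] that by auto
  have "c - a \<noteq> smul s (b - a)" for s
  proof
    assume "c - a = smul s (b - a)"
    then have c: "c = a + smul s (b - a)" by (simp add: algebra_simps)
    have "c \<noteq> a" "c \<noteq> b" "a + b + c \<noteq> 0" using C(2,3) no_line by auto
    then show False unfolding c by (cases s) (simp_all add: exp3_simps add_ac)
  qed
  moreover have "d - a \<noteq> smul t (c - a) + smul s (b - a)" for s t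
  proof
    assume "d - a = smul t (c - a) + smul s (b - a)"
    then have d: "d = a + smul t (c - a) + smul s (b - a)" by (simp add: algebra_simps)
    have "d \<noteq> a" "d \<noteq> b" "d \<noteq> c" "a + b + d \<noteq> 0" "a + c + d \<noteq> 0" "b + c + d \<noteq> 0"
      "a + d \<noteq> b + c" "b + d \<noteq> a + c" "c + d \<noteq> a + b"
      using C(2,3) no_line no_plane by auto
    then show False unfolding d by (cases s; cases t) (simp_all add: exp3_simps add_ac)
  qed
  ultimately show ?thesis using C(3) by (auto simp: gen_Cons)
qed

text \<open>If the five points of \<open>S\<close> are distinct and form a Sidon set, their
  differences fill 21 of the 27 vectors. The six left over are three opposite pairs, one for each
  splitting of \<open>a, b, c, d\<close> into two pairs.\<close>

lemma small_differences:
  fixes a b c d :: "'a::ab_group_exp3"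
  defines "S \<equiv> {a, b, c, d, a + b + c + d}"
  assumes "v \<in> gen [d - a, c - a, b - a]"
  shows "(\<exists>p\<in>S. \<exists>q\<in>S. v = p - q) \<or> v \<in> {a + b - c - d, c + d - a - b,
    a + c - b - d, b + d - a - c, a + d - b - c, b + c - a - d}"
proof -
  obtain x y z where v: "v = smul x (d - a) + (smul y (c - a) + smul z (b - a))"
    using assms(2) by (auto simp: gen_Cons)
  show ?thesis
    unfolding v S_def by (cases x; cases y; cases z) (simp_all add: exp3_simps add_ac)
qed

lemma no_sidon_14:
  fixes C :: "'a::{ab_group_exp3,finite} set"
  assumes C: "sidon C" and card: "CARD('a) = 243"
  shows "card C \<noteq> 14"
proof
  assume card14: "card C = 14"
  obtain a b c d e where abcde: "{a, b, c, d, e} \<subseteq> C" "distinct [a, b, c, d, e]"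
    and e: "e = a + b + c + d"
    using sidon_five_dependency[OF C card14 card] .
  let ?V = "[d - a, c - a, b - a]"
  have V: "indep ?V" using indep_sidon4[OF C, of a b c d] abcde by simp
  have in_V: "{b - a, c - a, d - a} \<subseteq> gen ?V" using set_subset_gen[of ?V] by simp
  have "e - a = (b - a) + ((c - a) + (d - a))" by (simp add: e exp3_simps add_ac)
  with in_V have e_V: "e - a \<in> gen ?V" by (metis gen_add insert_subset)
  let ?P = "C - {a, b, c, d, e}"
  have P_out: "p - a \<notin> gen ?V" if p: "p \<in> ?P" for p
  proof
    assume "p - a \<in> gen ?V"
    then have *: "x - a \<in> gen ?V" if "x \<in> {a, b, c, d, e, p}" for x
      using that in_V e_V by auto
    have "x - y \<in> gen ?V" if "x \<in> {a, b, c, d, e, p}" "y \<in> {a, b, c, d, e, p}" for x y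
      using gen_diff[OF *[OF that(1)] *[OF that(2)]] by simp
    moreover have "sidon {a, b, c, d, e, p}"
      by (rule sidon_subset[OF C]) (use abcde p in auto)
    ultimately have "card {a, b, c, d, e, p} * (card {a, b, c, d, e, p} - 1) < card (gen ?V)"
      by (intro card_sidon_in_coset_le) auto
    moreover have "card {a, b, c, d, e, p} = 6" using abcde p by auto
    ultimately show False using card_gen[OF V] by simp
  qed
  have "card ?P = 9" using card14 abcde by (subst card_Diff_subset) auto
  then obtain v where "card {p \<in> ?P. p - a \<in> gen (v # ?V)} \<ge> 3"
    using ex_line_of_three[OF V, of ?P a] card by auto
  then obtain f g h where fgh: "{f, g, h} \<subseteq> ?P" "distinct [f, g, h]" "g - f \<in> gen ?V"
      "g - a \<in> gen ((f - a) # ?V)" "h - a \<in> gen ((f - a) # ?V)"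
    using ex_two_in_coset P_out by blast
  let ?H = "(f - a) # ?V"
  have H: "indep ?H" using V P_out fgh(1) by simp
  define A B where "A = {p \<in> C. p - a \<in> gen ?H}" and "B = {p \<in> C. p - a \<notin> gen ?H}"
  have "x - y \<in> gen ?H" if "x \<in> A" "y \<in> A" for x y
    using gen_diff[of "x - a" ?H "y - a"] that by (simp add: A_def)
  moreover have "sidon A" by (rule sidon_subset[OF C]) (simp add: A_def)
  ultimately have *: "card A * (card A - 1) < card (gen ?H)"
    by (intro card_sidon_in_coset_le) simp_all
  \<comment> \<open>Ten points would have 90 nonzero differences in a space of 81 vectors.\<close>
  have "card A \<le> 9"
  proof (rule ccontr)
    assume "\<not> ?thesis"
    then have "10 * 9 \<le> card A * (card A - 1)" by (intro mult_le_mono) simp_all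
    then show False using * card_gen[OF H] by simp
  qed
  moreover have "card (A \<union> B) = card A + card B"
    by (rule card_Un_disjoint) (auto simp: A_def B_def)
  moreover have "A \<union> B = C" by (auto simp: A_def B_def)
  ultimately have "card B \<ge> 5" using card14 by simp
  moreover have "p - a \<notin> gen ?H" if "p \<in> B" for p using that by (simp add: B_def)
  ultimately obtain k where "k \<in> B" and "card {p \<in> B. p - k \<in> gen ?H} \<ge> 3"
    using ex_level_of_three[OF H, of B a] card by auto
  moreover have "card {p \<in> B. p - k \<in> gen ?H} \<le> card {p \<in> C. p - k \<in> gen ?H}"
    by (intro card_mono) (auto simp: B_def)
  ultimately have k: "k \<in> C" "k - a \<notin> gen ?H" and level: "card {p \<in> C. p - k \<in> gen ?H} \<ge> 3"
    by (simp_all add: B_def)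

  \<comment> \<open>The six possible values of \<open>g - f\<close> are related by permuting
    \<open>b, c, d\<close> and, for the sign, swapping \<open>f\<close> and \<open>g\<close>. The
    origin \<open>a\<close> and the hyperplane stay fixed.\<close>
  have conclude: False
    if perm: "{b', c', d'} = {b, c, d}" "distinct [b', c', d']" "{f', g'} = {f, g}"
      and g': "g' - f' = a + b' - c' - d'" for b' c' d' f' g'
  proof -
    let ?V' = "[d' - a, c' - a, b' - a]"
    have V': "gen ?V' = gen ?V"
    proof (rule gen_cong)
      have "set ?V' = (\<lambda>x. x - a) ` {b', c', d'}" by auto
      also have "\<dots> = set ?V" unfolding perm(1) by auto
      finally show "set ?V' = set ?V" .
    qed
    have "{b', c', d'} \<subseteq> C - {a}" unfolding perm(1) using abcde by auto
    then have C': "{a, b', c', d'} \<subseteq> C" "distinct [a, b', c', d']"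
      using abcde(1) perm(2) by simp_all blast
    have "f' \<in> {f', g'}" "g' \<in> {f', g'}" by simp_all
    then have f'_in: "f' \<in> {f, g}" and g'_in: "g' \<in> {f, g}" unfolding perm(3) .
    then have f': "f' \<in> ?P" using fgh(1) by blast
    \<comment> \<open>When \<open>f'\<close> is \<open>g\<close>, the hyperplane has to be generated
      anew with \<open>g - a\<close> in place of \<open>f - a\<close>.\<close>
    have "f' - a \<in> gen ?H" using f'_in set_subset_gen[of ?H] fgh(4) by auto
    moreover have "f' - a \<notin> gen ?V" using P_out[OF f'] .
    ultimately have "gen ?H = gen ((f' - a) # ?V)"
      using set_subset_gen[of ?V] set_subset_gen[of ?H] gen_exchange[of "f' - a" "f - a" ?V] gen_Cons_superset[of ?V "f - a"]
      by (intro equalityI gen_minimal) auto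
    also have "\<dots> = gen ((f' - a) # ?V')"
      unfolding gen_Cons[of "f' - a"] V' ..
    finally have H': "gen ?H = gen ((f' - a) # ?V')" .
    have "indep ((k - a) # (f' - a) # ?V')"
      using k(2) P_out[OF f'] indep_sidon4[OF C C'] unfolding H' V' indep.simps by blast
    then have "card C < 14"
    proof (rule sidon_configuration_card[OF C card refl, where h = h])
      have sum: "a + b' + c' + d' = e"
      proof -
        \<comment> \<open>Summing over the set makes the invariance under the permutation
          immediate.\<close>
        have "a + b' + c' + d' = a + \<Sum>{b', c', d'}" using perm(2) by (simp add: add_ac)
        also have "\<dots> = e" unfolding perm(1) using abcde(2) by (simp add: e add_ac)
        finally show ?thesis .
      qed
      have g'': "f' + (a + b' - c' - d') = g'" using g' by (simp add: algebra_simps)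
      show "{a, b', c', d', f', k, a + b' + c' + d', f' + (a + b' - c' - d')} \<subseteq> C"
        unfolding sum g'' using C'(1) f' g'_in k(1) fgh(1) abcde(1) by auto
      have "h \<notin> {b', c', d'}" unfolding perm(1) using fgh(1) by auto
      then show "h \<in> C - {a, b', c', d', f', a + b' + c' + d', f' + (a + b' - c' - d')}"
        unfolding sum g'' using fgh(1,2) f'_in g'_in by auto
      show "h - a \<in> gen (tl [k - a, f' - a, d' - a, c' - a, b' - a])"
        using fgh(5) H' by simp
      show "3 \<le> card {p \<in> C. p - k \<in> gen (tl [k - a, f' - a, d' - a, c' - a, b' - a])}"
        using level H' by simp
    qed
    then show False using card14 by simp
  qed
  \<comment> \<open>As \<open>f\<close> and \<open>g\<close> are distinct points outside the five,
    their difference repeats none of the differences of the five.\<close>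
  have "g - f \<noteq> p - q" if "p \<in> {a, b, c, d, e}" "q \<in> {a, b, c, d, e}" for p q
    using sidon_diffD[OF C, of g f p q] that fgh(1,2) abcde(1) by auto
  then have "g - f \<in> {a + b - c - d, c + d - a - b, a + c - b - d, b + d - a - c,
      a + d - b - c, b + c - a - d}"
    using small_differences[OF fgh(3)] unfolding e by blast
  then consider "g - f = a + b - c - d" | "f - g = a + b - c - d" | "g - f = a + c - b - d"
    | "f - g = a + c - b - d" | "g - f = a + d - b - c" | "f - g = a + d - b - c"
    by (force simp: algebra_simps)
  then show False
  proof cases
    case 1 then show False by (intro conclude[of b c d f g]) (use abcde in auto)
  next
    case 2 then show False by (intro conclude[of b c d g f]) (use abcde in auto)
  next
    case 3 then show False by (intro conclude[of c b d f g]) (use abcde in auto)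
  next
    case 4 then show False by (intro conclude[of c b d g f]) (use abcde in auto)
  next
    case 5 then show False by (intro conclude[of d b c f g]) (use abcde in auto)
  next
    case 6 then show False by (intro conclude[of d b c g f]) (use abcde in auto)
  qed
qed

corollary card_sidon_le_13:
  fixes C :: "'a::{ab_group_exp3,finite} set"
  assumes "sidon C" "CARD('a) = 243"
  shows "card C \<le> 13"
proof (rule ccontr)
  assume "\<not> card C \<le> 13"
  then have "14 \<le> card C" by simp
  then obtain D where "D \<subseteq> C" "card D = 14" by (meson obtain_subset_with_card_n)
  then show False using no_sidon_14[of D] assms sidon_subset by blast
qed

section \<open>A Sidon set with 13 elements\<close>

text \<open>An explicit witness beginning with the origin and the five unit vectors;
  \<open>cap13_fourth_point\<close> verifies it.\<close>

definition cap13 :: "trit list list" where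
  "cap13 = [[T0,T0,T0,T0,T0], [T1,T0,T0,T0,T0], [T0,T1,T0,T0,T0], [T0,T0,T1,T0,T0],
    [T0,T0,T0,T1,T0], [T0,T0,T0,T0,T1], [T1,T1,T1,T0,T0], [T0,T0,T1,T1,T1], [T0,T1,T1,T1,T2],
    [T0,T2,T1,T2,T0], [T1,T0,T2,T1,T2], [T2,T0,T2,T2,T0], [T2,T2,T1,T0,T1]]"

text \<open>Three points of a relation determine the fourth, so the Sidon property is checked on
  triples with a lookup instead of on quadruples.\<close>

lemma cap13_fourth_point:
  "\<forall>a\<in>set cap13. \<forall>b\<in>set cap13. \<forall>c\<in>set cap13. psub (padd a b) c \<in> set cap13 \<longrightarrow> a = c \<or> b = c"
  by code_simp

lemma ex_indep:
  "3 ^ n \<le> CARD('a::{ab_group_exp3,finite}) \<Longrightarrow> \<exists>vs :: 'a list. length vs = n \<and> indep vs"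
proof (induction n)
  case (Suc n)
  then obtain vs :: "'a list" where vs: "length vs = n" "indep vs" by auto
  have "3 ^ length vs < (3 :: nat) ^ Suc n" using vs by simp
  also have "\<dots> \<le> CARD('a)" by (rule Suc.prems)
  finally obtain v where "v \<notin> gen vs" by (rule ex_indep_extension)
  then show ?case using vs by (intro exI[of _ "v # vs"]) simp
qed simp

lemma ex_sidon_13:
  assumes "CARD('a::{ab_group_exp3,finite}) = 243"
  shows "\<exists>C :: 'a set. sidon C \<and> card C = 13"
proof -
  obtain vs :: "'a list" where vs: "length vs = 5" "indep vs"
    using ex_indep[where 'a = 'a and n = 5] assms by auto
  have len: "length x = 5" if "x \<in> set cap13" for x
    using that by (auto simp: cap13_def)
  have inj: "inj_on (lincomb vs) {ts. length ts = 5}"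
    using inj_on_lincomb[OF vs(2)] vs(1) by simp
  have "sidon (lincomb vs ` set cap13)"
    unfolding sidon_def
  proof (intro ballI impI)
    fix a b c d assume "a \<in> lincomb vs ` set cap13" "b \<in> lincomb vs ` set cap13"
      "c \<in> lincomb vs ` set cap13" "d \<in> lincomb vs ` set cap13" and eq: "a + b = c + d"
    then obtain x y z w where x: "{x, y, z, w} \<subseteq> set cap13"
      and abcd: "a = lincomb vs x" "b = lincomb vs y" "c = lincomb vs z" "d = lincomb vs w"
      by auto
    have l: "length x = 5" "length y = 5" "length z = 5" "length w = 5" using x len by auto
    then have "lincomb vs (psub (padd x y) z) = a + b - c"
      using vs(1) abcd by (simp add: lincomb_psub lincomb_padd length_padd)
    then have "lincomb vs (psub (padd x y) z) = lincomb vs w"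
      using eq abcd by (simp add: algebra_simps)
    then have "psub (padd x y) z = w"
      using inj l by (auto simp: inj_on_def length_psub length_padd)
    then have "x = z \<or> y = z" using cap13_fourth_point x by auto
    then show "a = c \<and> b = d \<or> a = d \<and> b = c" using eq abcd by auto
  qed
  moreover have "card (lincomb vs ` set cap13) = 13"
  proof -
    have "card (lincomb vs ` set cap13) = card (set cap13)"
      using len by (intro card_image inj_on_subset[OF inj]) auto
    then show ?thesis by (simp add: cap13_def)
  qed
  ultimately show ?thesis by blast
qed

section \<open>2-caps are Sidon sets\<close>

instance Enum.finite_3 :: ab_group_exp3
proof
  fix x :: F3 show "x + x + x = 0"
    by (cases x) (simp_all add: plus_finite_3_def zero_finite_3_def)
qed

instance vec :: (ab_group_exp3, finite) ab_group_exp3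
  by standard (simp add: vec_eq_iff triple)

lemma scale_F3_cases: "c *s x \<in> {0, x, - x}" for c :: F3 and x :: "F3 ^ 'n"
proof -
  have "c = 0 \<or> c = 1 \<or> c = - 1"
    by (cases c) (simp_all add: zero_finite_3_def one_finite_3_def uminus_finite_3_def)
  then show ?thesis by (auto simp: vec_eq_iff)
qed

text \<open>Scaling only produces \<open>0\<close>, \<open>x\<close> and \<open>- x\<close>, so the
  vector space span agrees with the span built from trits.\<close>

lemma span_F3: "vec.span (set vs) = gen vs" for vs :: "(F3 ^ 'n) list"
proof (rule vec.span_unique)
  show "set vs \<subseteq> gen vs" by (rule set_subset_gen)
  show "vec.subspace (gen vs)"
    unfolding vec.subspace_def
  proof (intro conjI ballI allI)
    fix c and x :: "F3 ^ 'n" assume "x \<in> gen vs"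
    then have "{0, x, - x} \<subseteq> gen vs" by (simp add: gen_minus)
    then show "c *s x \<in> gen vs" using scale_F3_cases[of c x] by blast
  qed (auto intro: gen_add)
  fix T :: "(F3 ^ 'n) set" assume T: "set vs \<subseteq> T" "vec.subspace T"
  then show "gen vs \<subseteq> T"
  proof (induction vs)
    case (Cons v vs)
    have "smul t v \<in> T" for t
      using Cons.prems by (cases t) (auto intro: vec.subspace_0 vec.subspace_neg)
    then show ?case using Cons by (auto simp: gen_Cons intro!: vec.subspace_add)
  qed (auto intro: vec.subspace_0)
qed

lemma card_subspace_le:
  fixes S :: "(F3 ^ 'n) set"
  assumes "vec.subspace S"
  shows "card S \<le> 3 ^ vec.dim S"
proof -
  obtain B where B: "B \<subseteq> S" "vec.independent B" "S \<subseteq> vec.span B" "card B = vec.dim S"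
    using vec.basis_exists .
  obtain vs where vs: "set vs = B" "length vs = card B"
    using finite_distinct_list[OF finite[of B]] distinct_card by metis
  have "S \<subseteq> gen vs" using B(3) span_F3[of vs] vs(1) by simp
  then have "card S \<le> card (gen vs)" by (intro card_mono) auto
  also have "\<dots> \<le> 3 ^ vec.dim S" using card_gen_le[of vs] vs B(4) by simp
  finally show ?thesis .
qed

lemma affine_subspace_span:
  fixes p :: "'a::field ^ 'n"
  assumes "vec.independent B"
  shows "affine_subspace (card B) ((\<lambda>v. p + v) ` vec.span B)"
  using assms vec.dim_span_eq_card_independent vec.subspace_span unfolding affine_subspace_def by blast

lemma mem_translation_iff: "x \<in> (\<lambda>v. p + v) ` W \<longleftrightarrow> x - p \<in> W" for x p :: "'a::ab_group_add"
  by (auto intro: image_eqI[of _ _ "x - p"])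

text \<open>Three points on a line would require 6 < 3, four points in a plane 12 < 9.\<close>

lemma sidon_imp_no_dependent:
  fixes C :: "(F3 ^ 'n) set"
  assumes C: "sidon C" "T \<subseteq> C" "T \<subseteq> A" and A: "affine_subspace d A"
  shows "card T * (card T - 1) < 3 ^ d"
proof -
  obtain S p where S: "vec.subspace S" "vec.dim S = d" "A = (\<lambda>v. p + v) ` S"
    using A unfolding affine_subspace_def by blast
  have "card T * (card T - 1) < card S"
  proof (rule card_sidon_in_coset_le)
    show "sidon T" using C(1,2) by (rule sidon_subset)
    show "0 \<in> S" using S(1) by (rule vec.subspace_0)
    fix x y assume "x \<in> T" "y \<in> T"
    then obtain u v where "x = p + u" "y = p + v" "u \<in> S" "v \<in> S" using C(3) S(3) by blast
    then show "x - y \<in> S" using vec.subspace_diff[OF S(1)] by simp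
  qed auto
  also have "\<dots> \<le> 3 ^ d" using card_subspace_le[OF S(1)] S(2) by simp
  finally show ?thesis .
qed

lemma add_smul_diff_cases:
  fixes a c d :: "'a::ab_group_exp3"
  assumes "c = a + smul t (d - a)"
  shows "c = a \<or> c = d \<or> a + d + c = 0"
  unfolding assms by (cases t) (simp_all add: exp3_simps add_ac)

text \<open>Counting differences turns Sidon sets into caps. Conversely, a nontrivial relation
  \<open>a + b = c + d\<close> puts its points on a line if two of them coincide, and in a plane
  otherwise.\<close>

lemma two_cap_iff_sidon: "two_cap C \<longleftrightarrow> sidon C" for C :: "(F3 ^ 'n) set"
proof
  assume C: "sidon C"
  show "two_cap C"
    unfolding two_cap_def
  proof (intro conjI allI impI notI)
    fix T assume T: "T \<subseteq> C" "card T = 3" "\<exists>A. affine_subspace 1 A \<and> T \<subseteq> A"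
    then obtain A where "affine_subspace 1 A" "T \<subseteq> A" by blast
    from sidon_imp_no_dependent[OF C T(1) this(2,1)] show False using T(2) by simp
  next
    fix T assume T: "T \<subseteq> C" "card T = 4" "\<exists>A. affine_subspace 2 A \<and> T \<subseteq> A"
    then obtain A where "affine_subspace 2 A" "T \<subseteq> A" by blast
    from sidon_imp_no_dependent[OF C T(1) this(2,1)] show False using T(2) by simp
  qed
next
  assume C: "two_cap C"
  have line: "a + b + c \<noteq> 0" if abc: "{a, b, c} \<subseteq> C" "distinct [a, b, c]" for a b c
  proof
    assume "a + b + c = 0"
    then have "c = - (a + b)" by (metis minus_unique)
    then have c: "c = a + - (b - a)" by (simp only: exp3_simps add_ac)
    have "b - a \<in> vec.span {b - a}" by (rule vec.span_base) simp
    moreover from this have "- (b - a) \<in> vec.span {b - a}" by (rule vec.span_neg)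
    ultimately have "{a, b, c} \<subseteq> (\<lambda>v. a + v) ` vec.span {b - a}"
      unfolding c mem_translation_iff insert_subset using vec.span_zero by simp
    moreover have "vec.independent {b - a}" using abc(2) by auto
    ultimately have "\<exists>A. affine_subspace 1 A \<and> {a, b, c} \<subseteq> A"
      using affine_subspace_span[of "{b - a}" a] by auto
    moreover have "card {a, b, c} = 3" using abc(2) by simp
    ultimately show False using C abc(1) unfolding two_cap_def by blast
  qed
  have plane: "a + b \<noteq> c + d" if abcd: "{a, b, c, d} \<subseteq> C" "distinct [a, b, c, d]" for a b c d
  proof
    assume eq: "a + b = c + d"
    \<comment> \<open>The cap condition speaks of planes of dimension exactly 2, so
      \<open>a, c, d\<close> must first be shown not to be collinear.\<close>
    have indep: "vec.independent {c - a, d - a}"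
    proof (rule vec.independent_insertI)
      show "vec.independent {d - a}" using abcd(2) by auto
      show "c - a \<notin> vec.span {d - a}"
      proof
        assume "c - a \<in> vec.span {d - a}"
        then have "c - a \<in> gen [d - a]" using span_F3[of "[d - a]"] by simp
        then obtain t where "c - a = smul t (d - a)" by (auto simp: gen_Cons)
        then have "c = a + smul t (d - a)" by (simp add: algebra_simps)
        moreover have "c \<noteq> a" "c \<noteq> d" "a + d + c \<noteq> 0" using line abcd by auto
        ultimately show False using add_smul_diff_cases by blast
      qed
    qed
    have "b = a + ((c - a) + (d - a))" using eq by (simp add: algebra_simps)
    moreover have "c - a \<in> vec.span {c - a, d - a}" "d - a \<in> vec.span {c - a, d - a}"
      by (auto intro: vec.span_base)
    moreover from this have "(c - a) + (d - a) \<in> vec.span {c - a, d - a}" by (rule vec.span_add)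
    ultimately have "{a, b, c, d} \<subseteq> (\<lambda>v. a + v) ` vec.span {c - a, d - a}"
      unfolding mem_translation_iff insert_subset using vec.span_zero by simp
    moreover have "card {c - a, d - a} = 2" using abcd(2) by auto
    ultimately have "\<exists>A. affine_subspace 2 A \<and> {a, b, c, d} \<subseteq> A"
      using affine_subspace_span[OF indep, of a] by auto
    moreover have "card {a, b, c, d} = 4" using abcd(2) by simp
    ultimately show False using C abcd(1) unfolding two_cap_def by blast
  qed
  have double: "a = b" if "a \<in> C" "b \<in> C" "c \<in> C" "a + b = c + c" for a b c
  proof (rule ccontr)
    assume "a \<noteq> b"
    moreover have "a \<noteq> c" "b \<noteq> c" using \<open>a \<noteq> b\<close> that(4) by auto
    moreover have "a + b + c = 0" by (simp only: that(4) triple)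
    ultimately show False using line[of a b c] that by auto
  qed
  show "sidon C"
    unfolding sidon_def
  proof (intro ballI impI)
    fix a b c d assume *: "a \<in> C" "b \<in> C" "c \<in> C" "d \<in> C" and eq: "a + b = c + d"
    consider "a = c" | "a = d" | "b = c" | "b = d" | "a = b" | "c = d" | "distinct [a, b, c, d]"
      by auto
    then show "a = c \<and> b = d \<or> a = d \<and> b = c"
    proof cases
      case 5
      then have "c = d" using double[of c d a] * eq by simp
      \<comment> \<open>What remains is \<open>a + a = c + c\<close>, and doubling is negation in
        exponent 3.\<close>
      with 5 eq have "- a = - c" by (simp only: exp3_simps(1))
      with 5 \<open>c = d\<close> show ?thesis by simp
    next
      case 6
      then have "a = b" using double[of a b c] * eq by simp
      with 6 eq have "- a = - c" by (simp only: exp3_simps(1))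
      with 6 \<open>a = b\<close> show ?thesis by simp
    next
      case 7 then show ?thesis using plane[of a b c d] * eq by auto
    qed (use eq in \<open>auto simp: add_ac\<close>)
  qed
qed

theorem theorem3p10:
  shows "(\<forall>C :: (F3 ^ 5) set. maximal_two_cap C \<longrightarrow> card C = 13) \<and> r2 TYPE(F3 ^ 5) = 13"
proof -
  have "CARD(F3) = 3" by (simp add: UNIV_finite_3)
  then have card: "CARD(F3 ^ 5) = 243" by simp
  have "r2 TYPE(F3 ^ 5) = 13"
    unfolding r2_def two_cap_iff_sidon
  proof (rule Max_eqI)
    fix n assume "n \<in> card ` {C :: (F3 ^ 5) set. sidon C}"
    then show "n \<le> 13" using card_sidon_le_13[OF _ card] by blast
  next
    show "13 \<in> card ` {C :: (F3 ^ 5) set. sidon C}" using ex_sidon_13[OF card] by force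
  qed simp
  then show ?thesis by (simp add: maximal_two_cap_def)
qed

end
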